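(* Let $c>1$ and let $\delta_c\in(0,\frac{\pi}{2})$ be a decay rate of $H_c$, that is, such that $x\mapsto e^{\delta_c|x|}xH_c(x)$ belongs to $L_2(\mathbb{R})$. Let $\phi$ be a solution to the steady Whitham equation $\phi(c-\phi)=H_c*\phi^2$ with $\phi(x)\to 0$ as $|x|\to\infty$. Then there exists $\nu$ with $0<\nu<\delta_c$ such that $x\mapsto e^{\nu|x|}\phi(x)$ belongs to $L_1(\mathbb{R})\cap L_\infty(\mathbb{R})$.
   Context: The Fourier transform is $\mathcal{F}(f)(\xi)=\int_{\mathbb{R}}f(x)e^{-ix\xi}\,dx$, extended to tempered distributions. Put $m(\xi)=\left(\frac{\tanh\xi}{\xi}\right)^{1/2}$ (with $m(0)=1$), $K=\mathcal{F}^{-1}(m)\in L_1(\mathbb{R})$, and for $c>1$ (supercritical wave speed) $H_c=\mathcal{F}^{-1}\left(\frac{m}{c-m}\right)$. A solution to the steady Whitham equation with wave speed $c$ is a real-valued, continuous, bounded function $\phi:\mathbb{R}\to\mathbb{R}$ satisfying $-c\phi+\phi^2+K*\phi=0$ pointwise on $\mathbb{R}$; for $c>1$ this is equivalently rewritten as $\phi(c-\phi)=H_c*\phi^2$. *)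

theory Defs
  imports "HOL-Analysis.Analysis"
begin

definition fourier :: "(real \<Rightarrow> complex) \<Rightarrow> real \<Rightarrow> complex" where
  "fourier f \<xi> = (LINT x|lborel. f x * exp (- (\<i> * complex_of_real (x * \<xi>))))"

definition vderiv :: "(real \<Rightarrow> complex) \<Rightarrow> real \<Rightarrow> complex" where
  "vderiv f = (\<lambda>x. vector_derivative f (at x))"

definition schwartz :: "(real \<Rightarrow> complex) set" where
  "schwartz = {\<psi>. (\<forall>k x. (vderiv ^^ k) \<psi> differentiable (at x)) \<and>
      (\<forall>j k. bounded (range (\<lambda>x. x ^ j *\<^sub>R (vderiv ^^ k) \<psi> x)))}"

text \<open>Absolute convergence of all pairings with Schwartz functions forces \<open>u\<close> to be measurable and
  locally integrable, and (by the uniform boundedness principle) makes the induced functional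
  continuous, hence a tempered distribution.\<close>

definition defines_tempered :: "(real \<Rightarrow> complex) \<Rightarrow> bool" where
  "defines_tempered u \<longleftrightarrow> (\<forall>\<psi>\<in>schwartz. integrable lborel (\<lambda>x. u x * \<psi> x))"

definition regular_distribution :: "(real \<Rightarrow> complex) \<Rightarrow> (real \<Rightarrow> complex) \<Rightarrow> complex" where
  "regular_distribution u \<psi> = (LINT x|lborel. u x * \<psi> x)"

definition fourier_distribution ::
    "((real \<Rightarrow> complex) \<Rightarrow> complex) \<Rightarrow> (real \<Rightarrow> complex) \<Rightarrow> complex" where
  "fourier_distribution T \<psi> = T (fourier \<psi>)"

text \<open>The function \<open>u\<close> represents the inverse Fourier transform of \<open>g\<close> in the sense of tempered
  distributions. The Fourier transform being injective, this determines \<open>u\<close> up to null sets.\<close>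

definition is_inverse_fourier :: "(real \<Rightarrow> complex) \<Rightarrow> (real \<Rightarrow> complex) \<Rightarrow> bool" where
  "is_inverse_fourier u g \<longleftrightarrow> defines_tempered u \<and> defines_tempered g \<and>
     (\<forall>\<psi>\<in>schwartz.
        fourier_distribution (regular_distribution u) \<psi> = regular_distribution g \<psi>)"

definition whitham_symbol :: "real \<Rightarrow> real" where
  "whitham_symbol \<xi> = (if \<xi> = 0 then 1 else sqrt (tanh \<xi> / \<xi>))"

text \<open>The symbol is real and even, so its inverse Fourier transform has a real-valued
  representative.\<close>

definition is_H :: "real \<Rightarrow> (real \<Rightarrow> real) \<Rightarrow> bool" where
  "is_H c H \<longleftrightarrow> is_inverse_fourier (\<lambda>x. complex_of_real (H x))
     (\<lambda>\<xi>. complex_of_real (whitham_symbol \<xi> / (c - whitham_symbol \<xi>)))"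

definition convolution :: "(real \<Rightarrow> real) \<Rightarrow> (real \<Rightarrow> real) \<Rightarrow> real \<Rightarrow> real" where
  "convolution f g x = (LINT y|lborel. f (x - y) * g y)"

definition in_L2 :: "(real \<Rightarrow> real) \<Rightarrow> bool" where
  "in_L2 f \<longleftrightarrow> f \<in> borel_measurable lborel \<and> integrable lborel (\<lambda>x. (f x)\<^sup>2)"

definition in_Linf :: "(real \<Rightarrow> real) \<Rightarrow> bool" where
  "in_Linf f \<longleftrightarrow> f \<in> borel_measurable lborel \<and> (\<exists>C. AE x in lborel. \<bar>f x\<bar> \<le> C)"

definition steady_whitham_solution :: "real \<Rightarrow> (real \<Rightarrow> real) \<Rightarrow> (real \<Rightarrow> real) \<Rightarrow> bool" where
  "steady_whitham_solution c H \<phi> \<longleftrightarrow>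
     continuous_on UNIV \<phi> \<and> bounded (range \<phi>) \<and>
     (\<forall>x. \<phi> x * (c - \<phi> x) = convolution H (\<lambda>y. (\<phi> y)\<^sup>2) x)"

end

theory Submission
  imports Defs
begin

text \<open>Testing against a Gaussian shows that \<open>H\<close> is locally integrable; with the weighted \<open>L\<^sub>2\<close>
  bound, \<open>A = \<integral>|H z| exp (\<nu>|z|) dz\<close> is finite for every \<open>\<nu> < \<delta>\<close>. The truncated weight
  \<open>w x = exp (\<nu> min |x| N)\<close> satisfies \<open>w x \<le> exp (\<nu>|x - y|) w y\<close>. Where \<open>|\<phi>| \<le> \<epsilon> \<le> 1/2\<close>, the
  equation gives \<open>|\<phi>| \<le> 2 |H * \<phi>\<^sup>2|\<close>, and one factor \<open>\<phi>\<close> of \<open>\<phi>\<^sup>2\<close> is small there, so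
  \<open>sup w|\<phi>| \<le> const + 2\<epsilon>A sup w|\<phi>|\<close>. The last term is absorbed by the left-hand side, which is finite
  thanks to the truncation, and the resulting bound does not depend on \<open>N\<close>.\<close>

section \<open>The Gaussian is a Schwartz function\<close>

lemma bounded_poly_times_gaussian:
  fixes p :: "real poly"
  shows "bounded (range (\<lambda>x. x ^ n * (poly p x * exp (- x\<^sup>2))))"
proof (induction p arbitrary: n)
  case 0
  show ?case by (auto simp: bounded_iff intro: exI[of _ 0])
next
  case (pCons a p)
  \<comment> \<open>Monomials suffice: \<open>pCons a p\<close> evaluates to
    \<open>a + x * poly p x\<close>, so the remaining part falls under the induction hypothesis at
    \<open>Suc n\<close>, which is why \<open>n\<close> is arbitrary.\<close>
  have "\<bar>x ^ n * exp (- x\<^sup>2)\<bar> \<le> fact n * exp 1" for x :: real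
  proof -
    have "\<bar>x\<bar> \<le> 1 + x\<^sup>2"
      using zero_le_power2[of "\<bar>x\<bar> - 1/2"] by (simp add: power2_eq_square algebra_simps)
    then have "\<bar>x\<bar> ^ n \<le> (1 + x\<^sup>2) ^ n"
      by (intro power_mono) auto
    also have "\<dots> = fact n * ((1 + x\<^sup>2) ^ n / fact n)"
      by simp
    also have "\<dots> \<le> fact n * exp (1 + x\<^sup>2)"
    proof -
      \<comment> \<open>A single term of the exponential series is at most its sum, since all terms
        are nonnegative.\<close>
      have "(\<Sum>k\<in>{n}. (1 + x\<^sup>2) ^ k /\<^sub>R fact k) \<le> (\<Sum>k. (1 + x\<^sup>2) ^ k /\<^sub>R fact k)"
        by (intro sum_le_suminf summable_exp_generic) auto
      then have "(1 + x\<^sup>2) ^ n / fact n \<le> exp (1 + x\<^sup>2)"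
        by (simp add: exp_def field_simps)
      then show ?thesis
        by (intro mult_left_mono) auto
    qed
    finally have "\<bar>x\<bar> ^ n * exp (- x\<^sup>2) \<le> fact n * exp (1 + x\<^sup>2) * exp (- x\<^sup>2)"
      by (intro mult_right_mono) auto
    then show ?thesis
      by (simp add: abs_mult power_abs mult.assoc flip: exp_add)
  qed
  then have "bounded (range (\<lambda>x. a * (x ^ n * exp (- x\<^sup>2))))"
    by (intro boundedI[of _ "\<bar>a\<bar> * (fact n * exp 1)"]) (auto simp: abs_mult[of a] intro!: mult_left_mono)
  from bounded_plus_comp[OF this pCons.IH[of "Suc n"]] show ?case
    by (simp add: algebra_simps)
qed

text \<open>Products of a polynomial and the Gaussian are closed under differentiation, so every
  iterated derivative needed for \<open>schwartz\<close> has this one form. Here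
  \<open>[:0, 2:]\<close> is the polynomial 2X.\<close>

lemma vderiv_poly_gaussian:
  "((\<lambda>x. complex_of_real (poly p x * exp (- x\<^sup>2))) has_vector_derivative
     complex_of_real (poly (pderiv p - [:0, 2:] * p) x * exp (- x\<^sup>2))) (at x)"
proof -
  have "((\<lambda>x. poly p x * exp (- x\<^sup>2)) has_real_derivative
      poly (pderiv p - [:0, 2:] * p) x * exp (- x\<^sup>2)) (at x)"
    by (auto intro!: derivative_eq_intros simp: algebra_simps)
  then show ?thesis
    by (intro has_vector_derivative_of_real)
      (simp add: has_real_derivative_iff_has_vector_derivative)
qed

lemma gaussian_schwartz: "(\<lambda>x. complex_of_real (exp (- x\<^sup>2))) \<in> schwartz"
proof -
  let ?f = "\<lambda>p x. complex_of_real (poly p x * exp (- x\<^sup>2))"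
  have step: "vderiv (?f p) = ?f (pderiv p - [:0, 2:] * p)" for p
    unfolding vderiv_def by (rule ext) (rule vector_derivative_at[OF vderiv_poly_gaussian])
  have "\<exists>p. (vderiv ^^ k) (?f 1) = ?f p" for k
  proof (induction k)
    case 0
    show ?case by (rule exI[of _ 1]) simp
  next
    case (Suc k)
    then obtain p where "(vderiv ^^ k) (?f 1) = ?f p" ..
    then have "(vderiv ^^ Suc k) (?f 1) = ?f (pderiv p - [:0, 2:] * p)"
      by (simp only: funpow.simps comp_apply step)
    then show ?case ..
  qed
  moreover have "?f p differentiable (at x)" for p x
    using vderiv_poly_gaussian[of p x] by (rule differentiableI_vector)
  moreover have "bounded (range (\<lambda>x. x ^ j *\<^sub>R ?f p x))" for j p
    using bounded_poly_times_gaussian[of j p]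
    by (auto simp: bounded_iff norm_mult abs_mult)
  ultimately have "?f 1 \<in> schwartz"
    unfolding schwartz_def mem_Collect_eq by metis
  then show ?thesis by simp
qed

section \<open>Weighted integrability of the kernel\<close>

lemma integrable_exp_neg_abs:
  fixes a :: real
  assumes "0 < a"
  shows "integrable lborel (\<lambda>x. exp (- a * \<bar>x\<bar>))"
proof -
  have "(\<lambda>x. exp (- a * x)) absolutely_integrable_on {0..}"
    using integrable_on_exp_minus_to_infinity[OF assms, of 0]
    by (intro nonnegative_absolutely_integrable_1) auto
  then have I: "integrable lborel (\<lambda>x. indicator {0..} x * exp (- a * x))"
    by (simp add: set_integrable_def integrable_completion)
  from lborel_integrable_real_affine[OF I, of "-1" 0]
  have J: "integrable lborel (\<lambda>x. indicator {0..} (- x) * exp (a * x))"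
    by simp
  show ?thesis
    by (rule Bochner_Integration.integrable_bound[OF Bochner_Integration.integrable_add[OF I J]])
      (auto simp: indicator_def)
qed

lemma is_H_integrable_gaussian:
  assumes "is_H c H"
  shows "integrable lborel (\<lambda>x. H x * exp (- x\<^sup>2))"
proof -
  have "integrable lborel (\<lambda>x. complex_of_real (H x) * complex_of_real (exp (- x\<^sup>2)))"
    using assms bspec[OF _ gaussian_schwartz]
    unfolding is_H_def is_inverse_fourier_def defines_tempered_def by fast
  then have "integrable lborel (\<lambda>x. complex_of_real (H x * exp (- x\<^sup>2)))"
    by simp
  then show ?thesis
    by (simp only: complex_of_real_integrable_eq)
qed

text \<open>The factor \<open>x\<close> makes the \<open>L\<^sub>2\<close> hypothesis weak near 0,
  so the Gaussian hypothesis takes over for |x| \<le> 1. For |x| > 1, |H x| \<le> |x * H x|, and the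
  gap between \<nu> and \<delta> leaves a product of two square-integrable functions.\<close>

lemma kernel_weighted_integrable:
  assumes G: "integrable lborel (\<lambda>x. H x * exp (- x\<^sup>2))"
    and L2: "in_L2 (\<lambda>x. exp (\<delta> * \<bar>x\<bar>) * (x * H x))"
    and "\<nu> < \<delta>"
  shows "integrable lborel (\<lambda>x. exp (\<nu> * \<bar>x\<bar>) * H x)"
proof -
  have m: "(\<lambda>x. H x * exp (- x\<^sup>2)) \<in> borel_measurable borel"
    using borel_measurable_integrable[OF G] by simp
  have "(\<lambda>x. H x * exp (- x\<^sup>2) * exp (x\<^sup>2)) \<in> borel_measurable borel"
    by (rule borel_measurable_times[OF m]) measurable
  also have "(\<lambda>x. H x * exp (- x\<^sup>2) * exp (x\<^sup>2)) = H"
    by (rule ext) (simp add: exp_minus)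
  finally have [measurable]: "H \<in> borel_measurable borel" .
  let ?F = "\<lambda>x. exp (\<delta> * \<bar>x\<bar>) * (x * H x)"
  \<comment> \<open>The first summand dominates on |x| \<le> 1, where its constant pays for both the
    weight and the Gaussian; the other two come from ab \<le> a^2 + b^2 and dominate
    elsewhere.\<close>
  let ?B = "\<lambda>x. exp (\<bar>\<nu>\<bar> + 1) * \<bar>H x * exp (- x\<^sup>2)\<bar> + ((?F x)\<^sup>2 + exp (- (2 * (\<delta> - \<nu>)) * \<bar>x\<bar>))"
  have B: "integrable lborel ?B"
    using G L2 \<open>\<nu> < \<delta>\<close> unfolding in_L2_def
    by (intro Bochner_Integration.integrable_add integrable_mult_right integrable_abs
        integrable_exp_neg_abs) auto
  have le: "\<bar>exp (\<nu> * \<bar>x\<bar>) * H x\<bar> \<le> ?B x" for x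
  proof (cases "\<bar>x\<bar> \<le> 1")
    case True
    have "\<nu> * \<bar>x\<bar> \<le> \<bar>\<nu>\<bar> * 1"
      using True by (intro mult_mono) auto
    moreover have "x\<^sup>2 \<le> 1"
      using True by (simp add: abs_square_le_1)
    ultimately have "exp (\<nu> * \<bar>x\<bar>) * \<bar>H x\<bar> \<le> exp (\<bar>\<nu>\<bar> + 1 + - x\<^sup>2) * \<bar>H x\<bar>"
      by (intro mult_right_mono) auto
    also have "\<dots> = exp (\<bar>\<nu>\<bar> + 1) * \<bar>H x * exp (- x\<^sup>2)\<bar>"
      by (simp only: exp_add) (simp add: abs_mult)
    also have "\<dots> \<le> ?B x"
      by simp
    finally show ?thesis by (simp add: abs_mult)
  next
    case False
    let ?e = "exp (- (\<delta> - \<nu>) * \<bar>x\<bar>)"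
    have "exp (\<nu> * \<bar>x\<bar>) = ?e * exp (\<delta> * \<bar>x\<bar>)"
      by (simp add: algebra_simps flip: exp_add)
    then have "\<bar>exp (\<nu> * \<bar>x\<bar>) * H x\<bar> = ?e * (exp (\<delta> * \<bar>x\<bar>) * (1 * \<bar>H x\<bar>))"
      by (simp only: abs_mult abs_exp_cancel mult.assoc mult_1)
    also have "\<dots> \<le> ?e * (exp (\<delta> * \<bar>x\<bar>) * (\<bar>x\<bar> * \<bar>H x\<bar>))"
      using False by (intro mult_left_mono mult_right_mono) auto
    also have "\<dots> = ?e * \<bar>?F x\<bar>"
      by (simp add: abs_mult)
    also have "\<dots> \<le> \<bar>?F x\<bar>\<^sup>2 + ?e\<^sup>2"
      using sum_squares_bound[of ?e "\<bar>?F x\<bar>"]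
        mult_nonneg_nonneg[OF exp_ge_zero abs_ge_zero, of "- (\<delta> - \<nu>) * \<bar>x\<bar>" "?F x"]
      by linarith
    also have "?e\<^sup>2 = exp (- (2 * (\<delta> - \<nu>)) * \<bar>x\<bar>)"
      by (simp add: algebra_simps flip: exp_double)
    also have "\<bar>?F x\<bar>\<^sup>2 + exp (- (2 * (\<delta> - \<nu>)) * \<bar>x\<bar>) \<le> ?B x"
      by simp
    finally show ?thesis .
  qed
  show ?thesis
  proof (rule Bochner_Integration.integrable_bound[OF B])
    show "AE x in lborel. norm (exp (\<nu> * \<bar>x\<bar>) * H x) \<le> norm (?B x)"
      using order.trans[OF le abs_ge_self] by (intro AE_I2) (simp only: real_norm_def)
  qed measurable
qed

section \<open>Exponential decay by absorption\<close>

text \<open>The weight \<open>u\<close> at \<open>x\<close> is transferred to the kernel under the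
  integral; as \<open>K\<close> does not depend on \<open>y\<close>, reflection and translation
  leave the weighted norm of \<open>H\<close>.\<close>

lemma weighted_convolution_bound:
  assumes G: "integrable lborel (\<lambda>x. w x * \<bar>H x\<bar>)"
    and [measurable]: "H \<in> borel_measurable borel" "f \<in> borel_measurable borel"
    and bound: "\<And>y. u * \<bar>f y\<bar> \<le> w (x - y) * K" and "u > 0"
  shows "u * \<bar>convolution H f x\<bar> \<le> (LINT z|lborel. w z * \<bar>H z\<bar>) * K"
proof -
  let ?G = "\<lambda>z. w z * \<bar>H z\<bar>"
  have G': "integrable lborel (\<lambda>y. ?G (x - y) * K)"
    using lborel_integrable_real_affine[OF G, of "-1" x] by (intro integrable_mult_left) simp
  have le: "norm (u * (H (x - y) * f y)) \<le> ?G (x - y) * K" for y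
  proof -
    have "norm (u * (H (x - y) * f y)) = \<bar>H (x - y)\<bar> * (u * \<bar>f y\<bar>)"
      using \<open>u > 0\<close> by (simp add: abs_mult)
    also have "\<dots> \<le> \<bar>H (x - y)\<bar> * (w (x - y) * K)"
      by (intro mult_left_mono bound) auto
    finally show ?thesis by (simp add: mult_ac)
  qed
  have "integrable lborel (\<lambda>y. u * (H (x - y) * f y))"
    by (rule Bochner_Integration.integrable_bound[OF G'])
      (use le in \<open>auto intro!: AE_I2 order.trans[OF _ abs_ge_self]\<close>)
  then have "norm (LINT y|lborel. u * (H (x - y) * f y)) \<le> (LINT y|lborel. ?G (x - y) * K)"
    by (rule Bochner_Integration.integral_norm_bound_integral[OF _ G']) (rule le)
  moreover have "(LINT y|lborel. ?G (x - y)) = (LINT z|lborel. ?G z)"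
    using lborel_integral_real_affine[of "-1" ?G x] by simp
  ultimately show ?thesis
    using \<open>u > 0\<close> by (simp add: convolution_def abs_mult)
qed

lemma steady_solution_exponential_decay:
  assumes "c > 1" and "\<nu> > 0"
    and meas [measurable]: "H \<in> borel_measurable borel"
    and G: "integrable lborel (\<lambda>x. exp (\<nu> * \<bar>x\<bar>) * \<bar>H x\<bar>)"
    and sol: "steady_whitham_solution c H \<phi>"
    and lim: "(\<phi> \<longlongrightarrow> 0) at_infinity"
  shows "\<exists>C. \<forall>x. exp (\<nu> * \<bar>x\<bar>) * \<bar>\<phi> x\<bar> \<le> C"
proof -
  have eq: "\<phi> x * (c - \<phi> x) = convolution H (\<lambda>y. (\<phi> y)\<^sup>2) x" for x
    using sol by (simp add: steady_whitham_solution_def)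
  have [measurable]: "\<phi> \<in> borel_measurable borel"
    using sol by (auto simp: steady_whitham_solution_def intro: borel_measurable_continuous_onI)
  obtain M where M: "\<bar>\<phi> x\<bar> \<le> M" for x
    using sol by (auto simp: steady_whitham_solution_def bounded_iff)
  define A where "A = (LINT x|lborel. exp (\<nu> * \<bar>x\<bar>) * \<bar>H x\<bar>)"
  have "A \<ge> 0" unfolding A_def by (rule integral_nonneg_AE) auto
  \<comment> \<open>Small enough to absorb the term 2 A \<epsilon> S below and to keep c - \<phi>
    above 1/2; the summand 2 also covers A = 0.\<close>
  define \<epsilon> where "\<epsilon> = 1 / (4 * A + 2)"
  have \<epsilon>: "\<epsilon> > 0" "\<epsilon> \<le> 1/2" "2 * A * \<epsilon> \<le> 1/2"
    using \<open>A \<ge> 0\<close> by (auto simp: \<epsilon>_def field_simps)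
  have "\<forall>\<^sub>F x in at_infinity. \<bar>\<phi> x\<bar> < \<epsilon>"
    using tendstoD[OF lim \<epsilon>(1)] by (simp add: dist_norm)
  then obtain R where R: "\<bar>\<phi> x\<bar> \<le> \<epsilon>" if "R \<le> \<bar>x\<bar>" for x
    unfolding eventually_at_infinity by (auto intro: less_imp_le)
  have "M \<ge> 0" using M[of 0] by linarith
  \<comment> \<open>The first term bounds the weighted solution on |x| \<le> R, the second the
    effect of that region on the convolution. Neither involves the truncation level
    \<open>N\<close>.\<close>
  define B where "B = exp (\<nu> * R) * M + 2 * A * (exp (\<nu> * R) * M\<^sup>2)"
  have trunc: "exp (\<nu> * min \<bar>x\<bar> N) * \<bar>\<phi> x\<bar> \<le> 2 * B" for x N
  proof -
    define w where "w x = exp (\<nu> * min \<bar>x\<bar> N)" for x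
    define S where "S = (SUP x. w x * \<bar>\<phi> x\<bar>)"
    have w_pos: "w x > 0" for x
      by (simp add: w_def)
    have w_le: "w x \<le> exp (\<nu> * R)" if "\<bar>x\<bar> \<le> R" for x
      using that \<open>\<nu> > 0\<close> by (simp add: w_def)
    have w_leN: "w x \<le> exp (\<nu> * N)" for x
      using \<open>\<nu> > 0\<close> by (simp add: w_def)
    \<comment> \<open>This survives truncation because min |x| N is 1-Lipschitz in x.\<close>
    have w_shift: "w x \<le> exp (\<nu> * \<bar>x - y\<bar>) * w y" for x y
    proof -
      have "min \<bar>x\<bar> N \<le> \<bar>x - y\<bar> + min \<bar>y\<bar> N" by linarith
      then have "\<nu> * min \<bar>x\<bar> N \<le> \<nu> * (\<bar>x - y\<bar> + min \<bar>y\<bar> N)"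
        using \<open>\<nu> > 0\<close> by (intro mult_left_mono) auto
      then show ?thesis by (simp add: w_def distrib_left flip: exp_add)
    qed
    \<comment> \<open>Truncation is needed here: it makes \<open>S\<close> a genuine finite
      supremum.\<close>
    have "bdd_above (range (\<lambda>x. w x * \<bar>\<phi> x\<bar>))"
      using M w_leN by (intro bdd_aboveI[of _ "exp (\<nu> * N) * M"]) (auto intro!: mult_mono)
    then have S: "w x * \<bar>\<phi> x\<bar> \<le> S" for x
      unfolding S_def by (intro cSUP_upper) auto
    have "S \<ge> 0" using S[of 0] w_pos[of 0] by (smt (verit) mult_nonneg_nonneg abs_ge_zero)
    have sq: "w y * (\<phi> y)\<^sup>2 \<le> exp (\<nu> * R) * M\<^sup>2 + \<epsilon> * S" for y
    proof (cases "\<bar>y\<bar> \<le> R")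
      case True
      have "(\<phi> y)\<^sup>2 \<le> M\<^sup>2" using power_mono[OF M[of y] abs_ge_zero, of 2] by simp
      then have "w y * (\<phi> y)\<^sup>2 \<le> exp (\<nu> * R) * M\<^sup>2"
        using w_le[OF True] by (intro mult_mono) auto
      moreover have "0 \<le> \<epsilon> * S" using \<epsilon> \<open>S \<ge> 0\<close> by simp
      ultimately show ?thesis by linarith
    next
      case False
      \<comment> \<open>One factor is at most \<epsilon> in the far region; the other carries the
        weight and is bounded by \<open>S\<close>.\<close>
      have "w y * (\<phi> y)\<^sup>2 = \<bar>\<phi> y\<bar> * (w y * \<bar>\<phi> y\<bar>)"
        by (simp add: power2_eq_square)
      also have "\<dots> \<le> \<epsilon> * S"
        using False \<epsilon> R[of y] S[of y] w_pos[of y] by (intro mult_mono) (auto simp: less_imp_le)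
      also have "\<dots> \<le> exp (\<nu> * R) * M\<^sup>2 + \<epsilon> * S" by simp
      finally show ?thesis .
    qed
    have "w x * \<bar>\<phi> x\<bar> \<le> B + S / 2" for x
    proof (cases "\<bar>x\<bar> \<le> R")
      case True
      have "w x * \<bar>\<phi> x\<bar> \<le> exp (\<nu> * R) * M"
        using w_le[OF True] M[of x] by (intro mult_mono) auto
      moreover have "0 \<le> 2 * A * (exp (\<nu> * R) * M\<^sup>2)"
        using \<open>A \<ge> 0\<close> by simp
      ultimately show ?thesis
        using \<open>S \<ge> 0\<close> unfolding B_def by linarith
    next
      case False
      then have "1/2 \<le> \<bar>c - \<phi> x\<bar>"
        using R[of x] \<epsilon> \<open>c > 1\<close> by auto
      then have "\<bar>\<phi> x\<bar> * (1/2) \<le> \<bar>\<phi> x\<bar> * \<bar>c - \<phi> x\<bar>"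
        by (intro mult_left_mono) auto
      then have "\<bar>\<phi> x\<bar> \<le> 2 * \<bar>convolution H (\<lambda>y. (\<phi> y)\<^sup>2) x\<bar>"
        by (simp add: abs_mult flip: eq)
      then have "w x * \<bar>\<phi> x\<bar> \<le> w x * (2 * \<bar>convolution H (\<lambda>y. (\<phi> y)\<^sup>2) x\<bar>)"
        using w_pos[of x] by (intro mult_left_mono) auto
      moreover have "w x * \<bar>convolution H (\<lambda>y. (\<phi> y)\<^sup>2) x\<bar> \<le> A * (exp (\<nu> * R) * M\<^sup>2 + \<epsilon> * S)"
        unfolding A_def
      proof (rule weighted_convolution_bound[OF G])
        fix y
        have "w x * \<bar>(\<phi> y)\<^sup>2\<bar> \<le> exp (\<nu> * \<bar>x - y\<bar>) * w y * (\<phi> y)\<^sup>2"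
          using w_shift by (simp add: mult_right_mono)
        also have "\<dots> \<le> exp (\<nu> * \<bar>x - y\<bar>) * (exp (\<nu> * R) * M\<^sup>2 + \<epsilon> * S)"
          using sq[of y] by (simp add: mult.assoc)
        finally show "w x * \<bar>(\<phi> y)\<^sup>2\<bar> \<le> exp (\<nu> * \<bar>x - y\<bar>) * (exp (\<nu> * R) * M\<^sup>2 + \<epsilon> * S)" .
      qed (use w_pos in auto)
      moreover have "2 * A * \<epsilon> * S \<le> 1/2 * S"
        using \<epsilon> \<open>S \<ge> 0\<close> by (intro mult_right_mono) auto
      moreover have "0 \<le> exp (\<nu> * R) * M"
        using \<open>M \<ge> 0\<close> by simp
      ultimately show ?thesis
        unfolding B_def by (simp add: algebra_simps)
    qed
    \<comment> \<open>Taking the supremum over x; since S is finite, this gives S \<le> 2 B.\<close>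
    then have "S \<le> B + S / 2"
      unfolding S_def[symmetric] by (subst (1) S_def, intro cSUP_least) auto
    then show ?thesis
      using S[of x] by (simp add: w_def)
  qed
  have "exp (\<nu> * \<bar>x\<bar>) * \<bar>\<phi> x\<bar> \<le> 2 * B" for x
    \<comment> \<open>With N = |x| the truncation has no effect at x.\<close>
    using trunc[of x "\<bar>x\<bar>"] by simp
  then show ?thesis by blast
qed

theorem theorem3p12:
  fixes c \<delta> :: real and H \<phi> :: "real \<Rightarrow> real"
  assumes "c > 1"
    and "is_H c H"
    and "0 < \<delta>" and "\<delta> < pi / 2"
    and "in_L2 (\<lambda>x. exp (\<delta> * \<bar>x\<bar>) * (x * H x))"
    and "steady_whitham_solution c H \<phi>"
    and "(\<phi> \<longlongrightarrow> 0) at_infinity"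
  shows "\<exists>\<nu>. 0 < \<nu> \<and> \<nu> < \<delta> \<and>
    integrable lborel (\<lambda>x. exp (\<nu> * \<bar>x\<bar>) * \<phi> x) \<and>
    in_Linf (\<lambda>x. exp (\<nu> * \<bar>x\<bar>) * \<phi> x)"
proof -
  have G: "integrable lborel (\<lambda>x. H x * exp (- x\<^sup>2))"
    using assms(2) by (rule is_H_integrable_gaussian)
  note H = kernel_weighted_integrable[OF G assms(5)]
  \<comment> \<open>At \<nu> = 0 the weight is 1, so \<open>H\<close> itself is integrable.\<close>
  have "H \<in> borel_measurable borel"
    using borel_measurable_integrable[OF H[of 0]] \<open>0 < \<delta>\<close> by simp
  moreover have "integrable lborel (\<lambda>x. exp (\<delta> / 2 * \<bar>x\<bar>) * \<bar>H x\<bar>)"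
    using integrable_abs[OF H[of "\<delta> / 2"]] \<open>0 < \<delta>\<close> by (simp add: abs_mult)
  ultimately obtain C where C: "exp (\<delta> / 2 * \<bar>x\<bar>) * \<bar>\<phi> x\<bar> \<le> C" for x
    using steady_solution_exponential_decay[of c "\<delta> / 2" H \<phi>] assms by auto
  \<comment> \<open>Half of the decay rate \<delta>/2 is given up, so the factor exp (- \<delta>/4
    |x|) remains to ensure integrability.\<close>
  let ?f = "\<lambda>x. exp (\<delta> / 4 * \<bar>x\<bar>) * \<phi> x"
  have [measurable]: "\<phi> \<in> borel_measurable borel"
    using assms(6)
    by (auto simp: steady_whitham_solution_def intro: borel_measurable_continuous_onI)
  have f: "\<bar>?f x\<bar> \<le> C * exp (- (\<delta> / 4) * \<bar>x\<bar>)" for x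
  proof -
    have "\<bar>?f x\<bar> = exp (\<delta> / 2 * \<bar>x\<bar>) * \<bar>\<phi> x\<bar> * exp (- (\<delta> / 4) * \<bar>x\<bar>)"
      by (simp add: abs_mult mult_ac flip: exp_add mult.assoc)
    also have "\<dots> \<le> C * exp (- (\<delta> / 4) * \<bar>x\<bar>)"
      by (intro mult_right_mono C) auto
    finally show ?thesis .
  qed
  have "C \<ge> 0" using C[of 0] by (smt (verit) mult_nonneg_nonneg abs_ge_zero exp_ge_zero)
  have "integrable lborel (\<lambda>x. C * exp (- (\<delta> / 4) * \<bar>x\<bar>))"
    using \<open>0 < \<delta>\<close> by (intro integrable_mult_right integrable_exp_neg_abs) auto
  then have "integrable lborel ?f"
    by (rule Bochner_Integration.integrable_bound)
      (use f in \<open>auto intro!: AE_I2 order.trans[OF _ abs_ge_self]\<close>)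
  moreover have "\<bar>?f x\<bar> \<le> C" for x
    using \<open>0 < \<delta>\<close> \<open>C \<ge> 0\<close> by (intro order.trans[OF f]) (simp add: mult_left_le)
  then have "in_Linf ?f"
    unfolding in_Linf_def by (auto intro!: exI[of _ C] AE_I2)
  ultimately show ?thesis
    using \<open>0 < \<delta>\<close> by (intro exI[of _ "\<delta> / 4"]) auto
qed

end
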